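(* Let $k \ge 3$ and let $\phi$ be an instance of Exact-one-in-$k$-SAT with variables $x_1,\dots,x_n$ and clauses $C_1,\dots,C_m$. Consider the system of inner-product constraints on vectors described below. (i) If $\phi$ has a satisfying assignment, then there is a family of vectors in $\mathbb{R}^{2k}$ satisfying all the constraints exactly. (ii) Conversely, if $r \le 4k-1$, $\epsilon < 10^{-6}k^{-5}$, and there is a family of vectors in $\mathbb{R}^r$ satisfying every constraint up to an additive error of $\pm\epsilon$, then $\phi$ has a satisfying assignment.
   Context: Exact-one-in-$k$-SAT: each clause $C$ consists of $k$ variables $x_{i_1},\dots,x_{i_k}$ together with signs $s_1,\dots,s_k \in \{+1,-1\}$; an assignment $f:\{x_1,\dots,x_n\} \to \{+1,-1\}$ satisfies $C$ iff exactly one $g \in [k]$ has $s_g f(x_{i_g}) = -1$ (equivalently $\sum_{g=1}^k s_g f(x_{i_g}) = k-2$); $\phi$ is satisfiable iff some assignment satisfies all clauses. The constraint system: let $x_0$ be an extra reference variable and $C_0$ an extra reference clause. Let $I = [2k] \cup \left(\binom{[2k]}{2} \times \{\pm 1\}\right)$, where $\binom{[2k]}{2}$ is the set of pairs $(i,j)$ with $1 \le i < j \le 2k$. For every $x \in \{x_0,\dots,x_n\}$ there are vectors $u_{(x,s)}$, $s \in I$ (written $u_{(x,i)}$ for $i \in [2k]$ and $u_{(x,i,j,\pm 1)}$ for the others), and for every $C \in \{C_0,\dots,C_m\}$ a vector $u_C$. Let $p:[2k]\to[2k]$ be $p(i) = i+1$ for odd $i$ and $p(i) = i-1$ for even $i$.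 Internal variable constraints (for every $x \in \{x_0,\dots,x_n\}$): $u_{(x,s)} \cdot u_{(x,s)} = 1$ for all $s \in I$; $u_{(x,i)} \cdot u_{(x,j)} = \delta_{ij}$ for $i,j \in [2k]$; $u_{(x,i,j,+1)} \cdot u_{(x,i)} = u_{(x,i,j,+1)} \cdot u_{(x,j)} = \frac{1}{\sqrt{2}}$ and $u_{(x,i,j,-1)} \cdot u_{(x,i)} = -u_{(x,i,j,-1)} \cdot u_{(x,j)} = \frac{1}{\sqrt{2}}$ for $(i,j) \in \binom{[2k]}{2}$. External variable constraints (for every $x \in \{x_1,\dots,x_n\}$): $u_{(x_0,i)} \cdot u_{(x,j)} = 0$ for $i,j \in [2k]$ with $j \ne p(i)$; $u_{(x_0,i,p(i),+1)} \cdot u_{(x,i,p(i),+1)} = 0$ for odd $i \in [2k]$; $u_{(x_0,i,j,+1)} \cdot u_{(x,p(i),p(j),-1)} = 0$ for $(i,j) \in \binom{[2k]}{2}$ with $i,j$ both odd. Internal clause constraints: $u_{C_0} \cdot u_{C_0} = 1$; $u_{C_0} \cdot u_{(x_0,2g-1)} = \frac{1}{\sqrt{k}}$ for every $g \in [k]$; and for every clause $C \in \{C_1,\dots,C_m\}$ with variables $x_{i_1},\dots,x_{i_k}$ and signs $s_1,\dots,s_k$: $u_C \cdot u_C = 1$ and $u_C \cdot u_{(x_{i_g},2g)} = \frac{s_g}{\sqrt{k}}$ for every $g \in [k]$. External clause constraints: $u_{C_0} \cdot u_C = 1 - 2/k$ for every $C \in \{C_1,\dots,C_m\}$. *)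

theory Defs
  imports Complex_Main
begin

text \<open>Exact-one-in-k-SAT instance: variables x_1..x_n, clauses C_1..C_m.
  Clause c (1 \<le> c \<le> m) has variables var c g (1 \<le> g \<le> k), each in {1..n},
  and signs sg c g \<in> {1,-1}.\<close>

definition wf_instance :: "nat \<Rightarrow> nat \<Rightarrow> nat \<Rightarrow> (nat \<Rightarrow> nat \<Rightarrow> nat) \<Rightarrow> (nat \<Rightarrow> nat \<Rightarrow> real) \<Rightarrow> bool" where
  "wf_instance k n m var sg \<longleftrightarrow>
     (\<forall>c\<in>{1..m}. \<forall>g\<in>{1..k}. var c g \<in> {1..n} \<and> sg c g \<in> {1, -1})"

definition exact_one_sat :: "nat \<Rightarrow> nat \<Rightarrow> nat \<Rightarrow> (nat \<Rightarrow> nat \<Rightarrow> nat) \<Rightarrow> (nat \<Rightarrow> nat \<Rightarrow> real) \<Rightarrow> bool" where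
  "exact_one_sat k n m var sg \<longleftrightarrow>
     (\<exists>f :: nat \<Rightarrow> real. (\<forall>x\<in>{1..n}. f x \<in> {1, -1}) \<and>
        (\<forall>c\<in>{1..m}. card {g\<in>{1..k}. sg c g * f (var c g) = -1} = 1))"

text \<open>Names of the vectors: VX x i = u_(x,i) (x in 0..n, i in [2k]);
  VP x i j s = u_(x,i,j,s) with s = True for +1 and False for -1; VC c = u_(C_c), c in 0..m.\<close>
datatype vidx = VX nat nat | VP nat nat nat bool | VC nat

text \<open>Vectors of R^r are represented as functions nat \<Rightarrow> real, only coordinates < r matter.\<close>
definition ip :: "nat \<Rightarrow> (nat \<Rightarrow> real) \<Rightarrow> (nat \<Rightarrow> real) \<Rightarrow> real" where
  "ip r a b = (\<Sum>i<r. a i * b i)"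

definition pp :: "nat \<Rightarrow> nat" where
  "pp i = (if odd i then i + 1 else i - 1)"

definition constraints_hold ::
  "nat \<Rightarrow> nat \<Rightarrow> nat \<Rightarrow> (nat \<Rightarrow> nat \<Rightarrow> nat) \<Rightarrow> (nat \<Rightarrow> nat \<Rightarrow> real) \<Rightarrow> nat \<Rightarrow> real \<Rightarrow> (vidx \<Rightarrow> nat \<Rightarrow> real) \<Rightarrow> bool" where
  "constraints_hold k n m var sg r eps u \<longleftrightarrow>
   (let ok = (\<lambda>a b (v::real). \<bar>ip r (u a) (u b) - v\<bar> \<le> eps) in
    \<comment> \<open>internal variable constraints\<close>
    (\<forall>x\<in>{0..n}.
       (\<forall>i\<in>{1..2*k}. ok (VX x i) (VX x i) 1) \<and>
       (\<forall>i\<in>{1..2*k}. \<forall>j\<in>{1..2*k}. i < j \<longrightarrow> (\<forall>s. ok (VP x i j s) (VP x i j s) 1)) \<and>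
       (\<forall>i\<in>{1..2*k}. \<forall>j\<in>{1..2*k}. ok (VX x i) (VX x j) (if i = j then 1 else 0)) \<and>
       (\<forall>i\<in>{1..2*k}. \<forall>j\<in>{1..2*k}. i < j \<longrightarrow>
          ok (VP x i j True) (VX x i) (1 / sqrt 2) \<and>
          ok (VP x i j True) (VX x j) (1 / sqrt 2) \<and>
          ok (VP x i j False) (VX x i) (1 / sqrt 2) \<and>
          ok (VP x i j False) (VX x j) (- (1 / sqrt 2)))) \<and>
    \<comment> \<open>external variable constraints\<close>
    (\<forall>x\<in>{1..n}.
       (\<forall>i\<in>{1..2*k}. \<forall>j\<in>{1..2*k}. j \<noteq> pp i \<longrightarrow> ok (VX 0 i) (VX x j) 0) \<and>
       (\<forall>i\<in>{1..2*k}. odd i \<longrightarrow> ok (VP 0 i (pp i) True) (VP x i (pp i) True) 0) \<and>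
       (\<forall>i\<in>{1..2*k}. \<forall>j\<in>{1..2*k}. i < j \<and> odd i \<and> odd j \<longrightarrow>
          ok (VP 0 i j True) (VP x (pp i) (pp j) False) 0)) \<and>
    \<comment> \<open>internal clause constraints\<close>
    ok (VC 0) (VC 0) 1 \<and>
    (\<forall>g\<in>{1..k}. ok (VC 0) (VX 0 (2*g - 1)) (1 / sqrt (real k))) \<and>
    (\<forall>c\<in>{1..m}. ok (VC c) (VC c) 1 \<and>
       (\<forall>g\<in>{1..k}. ok (VC c) (VX (var c g) (2*g)) (sg c g / sqrt (real k)))) \<and>
    \<comment> \<open>external clause constraints\<close>
    (\<forall>c\<in>{1..m}. ok (VC 0) (VC c) (1 - 2 / real k)))"

end

(*
  A variable x contributes two nearly orthonormal systems e_i = u_(x_0,i) and v_j = u_(x,j) with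
  e_i . v_j close to 0 unless j = p(i).  These are 4k vectors in dimension r < 4k, so their Gram
  matrix is singular and some row violates strict diagonal dominance: |e_i . v_(p i)| is within
  O(k eps) of 1 for some i, i.e. v_(p i) is close to f e_i with f = 1 or f = -1.  The external
  constraints carry this sign to every other index with an extra loss of only O(sqrt eps), and f
  is the truth value of x.  Then u_C . e_(2g-1) is close to s_g f / sqrt k, and since
  u_(C_0) is close to (1 / sqrt k) times the sum of the e_(2g-1), the value of u_(C_0) . u_C forces
  the sum of the s_g f to lie within distance less than 2 of k - 2; by parity it equals k - 2.
  For the converse, take v_(p i) = f e_i for odd i and v_(p i) = - f e_i for even i.
*)
theory Submission
  imports Defs "HOL-Analysis.L2_Norm"
begin

section \<open>Inner products and norms in the first \<open>r\<close> coordinates\<close>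

definition nrm :: "nat \<Rightarrow> (nat \<Rightarrow> real) \<Rightarrow> real" where
  "nrm r a = sqrt (ip r a a)"

lemma ip_add_left: "ip r (\<lambda>t. a t + b t) c = ip r a c + ip r b c"
  and ip_add_right: "ip r c (\<lambda>t. a t + b t) = ip r c a + ip r c b"
  and ip_diff_left: "ip r (\<lambda>t. a t - b t) c = ip r a c - ip r b c"
  and ip_diff_right: "ip r c (\<lambda>t. a t - b t) = ip r c a - ip r c b"
  and ip_scale_left: "ip r (\<lambda>t. y * a t) c = y * ip r a c"
  and ip_scale_right: "ip r c (\<lambda>t. y * a t) = y * ip r c a"
  and ip_minus_left: "ip r (\<lambda>t. - a t) c = - ip r a c"
  and ip_minus_right: "ip r c (\<lambda>t. - a t) = - ip r c a"
  by (simp_all add: ip_def algebra_simps sum.distrib sum_subtractf sum_distrib_left sum_negf)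

lemma ip_sum_left: "ip r (\<lambda>t. \<Sum>g\<in>S. a g t) c = (\<Sum>g\<in>S. ip r (a g) c)"
  unfolding ip_def sum_distrib_right by (rule sum.swap)

lemma ip_sum_right: "ip r c (\<lambda>t. \<Sum>g\<in>S. a g t) = (\<Sum>g\<in>S. ip r c (a g))"
  unfolding ip_def sum_distrib_left by (rule sum.swap)

lemmas ip_linear = ip_add_left ip_add_right ip_diff_left ip_diff_right ip_scale_left
  ip_scale_right ip_minus_left ip_minus_right ip_sum_left ip_sum_right

lemma ip_commute: "ip r a b = ip r b a"
  by (simp add: ip_def mult.commute)

lemma ip_self_nonneg: "0 \<le> ip r a a"
  by (simp add: ip_def sum_nonneg)

lemma nrm_nonneg: "0 \<le> nrm r a"
  by (simp add: nrm_def ip_self_nonneg)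

lemma nrm_square: "(nrm r a)\<^sup>2 = ip r a a"
  by (simp add: nrm_def ip_self_nonneg)

lemma nrm_le_of_ip_self_le: "ip r a a \<le> y\<^sup>2 \<Longrightarrow> 0 \<le> y \<Longrightarrow> nrm r a \<le> y"
  by (simp add: nrm_def real_le_lsqrt)

lemma ip_Cauchy_Schwarz: "\<bar>ip r a b\<bar> \<le> nrm r a * nrm r b"
proof -
  have "\<bar>ip r a b\<bar> \<le> (\<Sum>i<r. \<bar>a i\<bar> * \<bar>b i\<bar>)"
    unfolding ip_def by (rule order_trans[OF sum_abs]) (simp add: abs_mult)
  also have "\<dots> \<le> L2_set a {..<r} * L2_set b {..<r}"
    by (rule L2_set_mult_ineq)
  also have "\<dots> = nrm r a * nrm r b"
    by (simp add: L2_set_def nrm_def ip_def power2_eq_square)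
  finally show ?thesis .
qed

section \<open>Linear dependence and diagonal dominance of Gram matrices\<close>

text \<open>Gaussian elimination, one coordinate at a time: a vector with nonzero last coordinate
  serves as pivot, clears that coordinate from the others and leaves the index set. Coefficients
  belong to indices, not to vectors, so coinciding vectors count separately.\<close>

lemma exists_linear_dependence:
  fixes V :: "'a \<Rightarrow> nat \<Rightarrow> real"
  assumes "finite S" "card S > r"
  shows "\<exists>c. (\<exists>l\<in>S. c l \<noteq> 0) \<and> (\<forall>t<r. (\<Sum>l\<in>S. c l * V l t) = 0)"
  using assms
proof (induction r arbitrary: S V)
  case 0
  then have "S \<noteq> {}" by auto
  then show ?case by (intro exI[of _ "\<lambda>_. 1"]) auto
next
  case (Suc r)
  show ?case
  proof (cases "\<forall>l\<in>S. V l r = 0")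
    case True
    obtain c where "\<exists>l\<in>S. c l \<noteq> 0" "\<forall>t<r. (\<Sum>l\<in>S. c l * V l t) = 0"
      using Suc.IH[of S V] Suc.prems by auto
    then show ?thesis
      using True by (intro exI[of _ c]) (auto simp: less_Suc_eq)
  next
    case False
    then obtain p where p: "p \<in> S" "V p r \<noteq> 0" by auto
    define W where "W l t = V l t - V l r / V p r * V p t" for l t
    have "card (S - {p}) > r" using Suc.prems p by simp
    then obtain c where c: "\<exists>l\<in>S - {p}. c l \<noteq> 0"
        and c0: "\<forall>t<r. (\<Sum>l\<in>S - {p}. c l * W l t) = 0"
      using Suc.IH[of "S - {p}" W] Suc.prems by auto
    \<comment> \<open>The coefficient of the pivot absorbs all multiples of \<open>V p\<close>
      subtracted in \<open>W\<close>, so the two combinations agree in every coordinate.\<close>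
    define d where "d = c(p := - (\<Sum>l\<in>S - {p}. c l * V l r / V p r))"
    have "(\<Sum>l\<in>S. d l * V l t) = (\<Sum>l\<in>S - {p}. c l * W l t)" for t
    proof -
      have "(\<Sum>l\<in>S. d l * V l t) = d p * V p t + (\<Sum>l\<in>S - {p}. d l * V l t)"
        using Suc.prems p by (simp add: sum.remove)
      also have "(\<Sum>l\<in>S - {p}. d l * V l t) = (\<Sum>l\<in>S - {p}. c l * V l t)"
        by (rule sum.cong) (auto simp: d_def)
      finally show ?thesis
        by (simp add: d_def W_def algebra_simps sum_subtractf sum_distrib_left sum_distrib_right)
    qed
    moreover have "W l r = 0" for l using p by (simp add: W_def)
    ultimately have "\<forall>t<Suc r. (\<Sum>l\<in>S. d l * V l t) = 0"
      using c0 by (auto simp: less_Suc_eq)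
    moreover have "\<exists>l\<in>S. d l \<noteq> 0" using c by (auto simp: d_def)
    ultimately show ?thesis by blast
  qed
qed

text \<open>The Levy-Desplanques argument: a linear dependence is a kernel vector of the Gram
  matrix, and the row at its entry of largest modulus cannot be strictly diagonally
  dominant.\<close>

lemma Gram_row_not_dominant:
  fixes V :: "'a \<Rightarrow> nat \<Rightarrow> real"
  assumes S: "finite S" "card S > r"
  shows "\<exists>p\<in>S. ip r (V p) (V p) \<le> (\<Sum>l\<in>S - {p}. \<bar>ip r (V l) (V p)\<bar>)"
proof -
  obtain c where c: "\<exists>l\<in>S. c l \<noteq> 0" and c0: "\<forall>t<r. (\<Sum>l\<in>S. c l * V l t) = 0"
    using exists_linear_dependence[OF S] by blast
  have "S \<noteq> {}" using c by auto
  then obtain p where p: "p \<in> S" and mx: "\<And>l. l \<in> S \<Longrightarrow> \<bar>c l\<bar> \<le> \<bar>c p\<bar>"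
    using S(1) obtains_MAX[of S "\<lambda>l. \<bar>c l\<bar>"] by (metis Max_ge finite_imageI imageI)
  have pos: "\<bar>c p\<bar> > 0" using c mx by force
  have "0 = ip r (\<lambda>t. \<Sum>l\<in>S. c l * V l t) (V p)"
    unfolding ip_def using c0 by simp
  also have "\<dots> = (\<Sum>l\<in>S. c l * ip r (V l) (V p))"
    by (simp add: ip_linear)
  also have "\<dots> = c p * ip r (V p) (V p) + (\<Sum>l\<in>S - {p}. c l * ip r (V l) (V p))"
    using S p by (simp add: sum.remove)
  finally have "\<bar>c p * ip r (V p) (V p)\<bar> = \<bar>\<Sum>l\<in>S - {p}. c l * ip r (V l) (V p)\<bar>"
    by linarith
  also have "\<dots> \<le> (\<Sum>l\<in>S - {p}. \<bar>c p\<bar> * \<bar>ip r (V l) (V p)\<bar>)"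
    by (rule order_trans[OF sum_abs], rule sum_mono) (auto simp: abs_mult intro!: mult_right_mono mx)
  finally have "\<bar>c p\<bar> * ip r (V p) (V p) \<le> \<bar>c p\<bar> * (\<Sum>l\<in>S - {p}. \<bar>ip r (V l) (V p)\<bar>)"
    using ip_self_nonneg[of r "V p"] by (simp add: abs_mult sum_distrib_left)
  then show ?thesis using pos p by auto
qed

section \<open>Propagation of a sign from one index to another\<close>

text \<open>Up to \<open>\<epsilon>\<close>, \<open>w\<close> has the length and the inner products
  of the normalised sum of \<open>e1\<close> and \<open>e2\<close>, so in the expansion of
  \<open>ip r \<eta> \<eta>\<close> the main terms cancel. Against \<open>e1 - e2\<close> the error
  is of first order in \<open>\<epsilon>\<close>, where Cauchy-Schwarz would only give order
  \<open>sqrt \<epsilon>\<close>.\<close>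

lemma near_half_sum:
  assumes e: "\<bar>ip r e1 e1 - 1\<bar> \<le> \<epsilon>" "\<bar>ip r e2 e2 - 1\<bar> \<le> \<epsilon>" "\<bar>ip r e1 e2\<bar> \<le> \<epsilon>"
    and w: "\<bar>ip r w w - 1\<bar> \<le> \<epsilon>" "\<bar>ip r w e1 - 1 / sqrt 2\<bar> \<le> \<epsilon>" "\<bar>ip r w e2 - 1 / sqrt 2\<bar> \<le> \<epsilon>"
  defines "\<eta> \<equiv> (\<lambda>t. w t - 1 / sqrt 2 * (e1 t + e2 t))"
  shows "ip r \<eta> \<eta> \<le> 6 * \<epsilon>" and "\<bar>ip r \<eta> (\<lambda>t. e1 t - e2 t)\<bar> \<le> 4 * \<epsilon>"
proof -
  define c :: real where "c = 1 / sqrt 2"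
  have c2: "c * c = 1 / 2" by (simp add: c_def)
  \<comment> \<open>This bound fits the budget exactly: \<open>\<epsilon>\<close> from
    \<open>w\<close>, \<open>2 * \<epsilon>\<close> from \<open>e1\<close> and \<open>e2\<close>,
    and \<open>4 * c * \<epsilon>\<close> from the mixed terms add up to at most
    \<open>6 * \<epsilon>\<close>.\<close>
  have "c < 3 / 4" 
    unfolding c_def by (rule power2_less_imp_less) (auto simp: power_divide power2_eq_square)
  have "c > 0" by (simp add: c_def)
  have eps: "\<epsilon> \<ge> 0" using e(1) by linarith
  have ce: "0 \<le> c * \<epsilon>" "c * \<epsilon> \<le> 3 / 4 * \<epsilon>"
    using \<open>c > 0\<close> mult_right_mono[OF less_imp_le[OF \<open>c < 3 / 4\<close>] eps] eps by auto
  have cm: "\<bar>y\<bar> \<le> \<epsilon> \<Longrightarrow> \<bar>c * y\<bar> \<le> c * \<epsilon>" for y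
    using \<open>c > 0\<close> by (simp add: abs_mult)
  have "ip r \<eta> \<eta> = ip r w w + (c * c) * (ip r e1 e1 + ip r e2 e2 + 2 * ip r e1 e2)
      - 2 * (c * (ip r w e1 - c)) - 2 * (c * (ip r w e2 - c)) - 4 * (c * c)"
    unfolding \<eta>_def c_def[symmetric]
    by (simp add: ip_linear ip_commute[of r e1 w] ip_commute[of r e2 w] ip_commute[of r e2 e1] algebra_simps)
  moreover define y1 y2 where "y1 = c * (ip r w e1 - c)" and "y2 = c * (ip r w e2 - c)"
  moreover have "\<bar>y1\<bar> \<le> c * \<epsilon>" "\<bar>y2\<bar> \<le> c * \<epsilon>"
    unfolding y1_def y2_def by (rule cm[OF w(2)[folded c_def]], rule cm[OF w(3)[folded c_def]])
  ultimately have "ip r \<eta> \<eta> = ip r w w + 1 / 2 * (ip r e1 e1 + ip r e2 e2 + 2 * ip r e1 e2)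
      - 2 * y1 - 2 * y2 - 2" and "\<bar>y1\<bar> \<le> c * \<epsilon>" "\<bar>y2\<bar> \<le> c * \<epsilon>"
    unfolding c2 by simp_all
  then show "ip r \<eta> \<eta> \<le> 6 * \<epsilon>"
    using ce(2) e w(1) by argo
  have "ip r \<eta> (\<lambda>t. e1 t - e2 t) = (ip r w e1 - c) - (ip r w e2 - c)
      - c * (ip r e1 e1 - 1) + c * (ip r e2 e2 - 1)"
    unfolding \<eta>_def c_def[symmetric]
    by (simp add: ip_linear ip_commute[of r e2 e1] algebra_simps)
  then show "\<bar>ip r \<eta> (\<lambda>t. e1 t - e2 t)\<bar> \<le> 4 * \<epsilon>"
    using cm[OF e(1)] cm[OF e(2)] ce w(2,3)[folded c_def] by linarith
qed

text \<open>
  The naive estimate of \<^term>\<open>ip r e1 v1 + ip r e2 v2\<close> has an error of order \<^term>\<open>sqrt \<epsilon>\<close>, which would only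
  give \<open>O(\<epsilon>\<^sup>1\<^sup>/\<^sup>4)\<close> here. The gain comes from the error vectors of \<open>w\<close> and \<open>z\<close> being
  nearly orthogonal to \<open>e1 - e2\<close> and \<open>v1 - v2\<close>, hence to \<open>v1 + v2\<close> and \<open>e1 + e2\<close> up to
  the very distances being estimated.
\<close>
lemma sign_propagation:
  assumes e: "\<bar>ip r e1 e1 - 1\<bar> \<le> \<epsilon>" "\<bar>ip r e2 e2 - 1\<bar> \<le> \<epsilon>" "\<bar>ip r e1 e2\<bar> \<le> \<epsilon>"
    and w: "\<bar>ip r w w - 1\<bar> \<le> \<epsilon>" "\<bar>ip r w e1 - 1 / sqrt 2\<bar> \<le> \<epsilon>" "\<bar>ip r w e2 - 1 / sqrt 2\<bar> \<le> \<epsilon>"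
    and v: "\<bar>ip r v1 v1 - 1\<bar> \<le> \<epsilon>" "\<bar>ip r v2 v2 - 1\<bar> \<le> \<epsilon>" "\<bar>ip r v1 v2\<bar> \<le> \<epsilon>"
    and z: "\<bar>ip r z z - 1\<bar> \<le> \<epsilon>" "\<bar>ip r z v1 - 1 / sqrt 2\<bar> \<le> \<epsilon>" "\<bar>ip r z v2 - 1 / sqrt 2\<bar> \<le> \<epsilon>"
    and ev: "\<bar>ip r e1 v2\<bar> \<le> \<epsilon>" "\<bar>ip r e2 v1\<bar> \<le> \<epsilon>"
    and wz: "\<bar>ip r w z\<bar> \<le> \<epsilon>"
    and f: "f \<in> {1, -1 :: real}"
  shows "nrm r (\<lambda>t. v2 t + f * e2 t) \<le> nrm r (\<lambda>t. v1 t - f * e1 t) + 22 * sqrt \<epsilon>"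
proof -
  define c :: real where "c = 1 / sqrt 2"
  have c2: "c * c = 1 / 2" by (simp add: c_def)
  have "c > 0" by (simp add: c_def)
  \<comment> \<open>Sharper than 3/4, because the coefficient 7/4 of \<open>m\<close> below requires
    \<open>c * 49 / 20 \<le> 7 / 4\<close>.\<close>
  have "c < 442 / 625"
    unfolding c_def by (rule power2_less_imp_less) (auto simp: power_divide power2_eq_square)
  have eps: "\<epsilon> \<ge> 0" using e(1) by linarith
  define P where "P = (\<lambda>t. v1 t - f * e1 t)"
  define Q where "Q = (\<lambda>t. v2 t + f * e2 t)"
  define s where "s = sqrt \<epsilon>"
  have s: "s \<ge> 0" "s * s = \<epsilon>" using eps by (auto simp: s_def)
  define A where "A = nrm r P"
  define B where "B = nrm r Q"
  have AB: "A \<ge> 0" "B \<ge> 0" by (auto simp: A_def B_def nrm_nonneg)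
  define \<eta> where "\<eta> = (\<lambda>t. w t - 1 / sqrt 2 * (e1 t + e2 t))"
  define \<theta> where "\<theta> = (\<lambda>t. z t - 1 / sqrt 2 * (v1 t + v2 t))"
  note \<eta> = near_half_sum[OF e w, folded \<eta>_def]
  note \<theta> = near_half_sum[OF v z, folded \<theta>_def]
  \<comment> \<open>49/20 is a rational just above the square root of 6.\<close>
  have "(49 / 20 * s)\<^sup>2 = 2401 / 400 * (s * s)" by (simp add: power2_eq_square)
  then have N2: "6 * \<epsilon> \<le> (49 / 20 * s)\<^sup>2" using s eps by simp
  have s49: "0 \<le> 49 / 20 * s" using s by simp
  have N: "nrm r \<eta> \<le> 49 / 20 * s" "nrm r \<theta> \<le> 49 / 20 * s"
    using nrm_le_of_ip_self_le[OF order_trans[OF \<eta>(1) N2] s49]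
      nrm_le_of_ip_self_le[OF order_trans[OF \<theta>(1) N2] s49] .
  have CS: "\<bar>ip r a P\<bar> \<le> 49 / 20 * (s * A)" "\<bar>ip r a Q\<bar> \<le> 49 / 20 * (s * B)" if "nrm r a \<le> 49 / 20 * s" for a
    using ip_Cauchy_Schwarz[of r a P] ip_Cauchy_Schwarz[of r a Q] that AB
      mult_right_mono[OF that AB(1)] mult_right_mono[OF that AB(2)] unfolding A_def B_def by linarith+
  define m where "m = s * A + s * B"
  have f2: "f * f = 1" "\<bar>f\<bar> = 1" using f by auto
  have fabs: "\<bar>f * y\<bar> = \<bar>y\<bar>" for y using f2 by (simp add: abs_mult)
  \<comment> \<open>The identity \<open>v1 + v2 = f * (e1 - e2) + P + Q\<close> trades a sum of the
    \<open>v\<close> for the difference of the \<open>e\<close>, to which \<open>\<eta>\<close> is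
    nearly orthogonal. The mirrored identity below does the same for
    \<open>\<theta>\<close>.\<close>
  have "ip r \<eta> (\<lambda>t. v1 t + v2 t) = f * ip r \<eta> (\<lambda>t. e1 t - e2 t) + ip r \<eta> P + ip r \<eta> Q"
    unfolding P_def Q_def by (simp add: ip_linear algebra_simps)
  then have h1: "\<bar>ip r \<eta> (\<lambda>t. v1 t + v2 t)\<bar> \<le> 4 * \<epsilon> + 49 / 20 * m"
    using \<eta>(2) CS[OF N(1)] m_def fabs[of "ip r \<eta> (\<lambda>t. e1 t - e2 t)"] by linarith
  have "ip r \<theta> (\<lambda>t. e1 t + e2 t) = f * ip r \<theta> (\<lambda>t. v1 t - v2 t) - f * ip r \<theta> P + f * ip r \<theta> Q"
    using f unfolding P_def Q_def by (auto simp: ip_linear algebra_simps)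
  then have h2: "\<bar>ip r \<theta> (\<lambda>t. e1 t + e2 t)\<bar> \<le> 4 * \<epsilon> + 49 / 20 * m"
    using \<theta>(2) CS[OF N(2)] m_def fabs[of "ip r \<theta> (\<lambda>t. v1 t - v2 t)"] fabs[of "ip r \<theta> P"]
      fabs[of "ip r \<theta> Q"] by linarith
  have "\<bar>ip r \<eta> \<theta>\<bar> \<le> (49 / 20 * s) * (49 / 20 * s)"
    using ip_Cauchy_Schwarz[of r \<eta> \<theta>] mult_mono[OF N] nrm_nonneg s by fastforce
  then have h3: "\<bar>ip r \<eta> \<theta>\<bar> \<le> 61 / 10 * \<epsilon>" using s eps by (simp add: algebra_simps)
  define a where "a = ip r e1 v1"
  define b where "b = ip r e2 v2"
  \<comment> \<open>Expand \<open>ip r w z\<close> with \<open>w = c * (e1 + e2) + \<eta>\<close>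
    and \<open>z = c * (v1 + v2) + \<theta>\<close>; its smallness forces \<open>a\<close> and
    \<open>b\<close> to be nearly opposite.\<close>
  have "c * c * (a + b + ip r e1 v2 + ip r e2 v1) = ip r w z
      - c * ip r \<eta> (\<lambda>t. v1 t + v2 t) - c * ip r \<theta> (\<lambda>t. e1 t + e2 t) - ip r \<eta> \<theta>"
    unfolding \<eta>_def \<theta>_def c_def[symmetric] a_def b_def
    by (simp add: ip_linear ip_commute[of r z] ip_commute[of r v1] ip_commute[of r v2] algebra_simps)
  moreover have cm: "\<bar>c * y\<bar> \<le> 442 / 625 * u" if "\<bar>y\<bar> \<le> u" for y u
  proof -
    have "\<bar>c * y\<bar> = c * \<bar>y\<bar>" using \<open>c > 0\<close> by (simp add: abs_mult)
    also have "\<dots> \<le> 442 / 625 * u" using \<open>c < 442 / 625\<close> \<open>c > 0\<close> that by (intro mult_mono) auto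
    finally show ?thesis .
  qed
  moreover define y1 y2 where "y1 = c * ip r \<eta> (\<lambda>t. v1 t + v2 t)"
    and "y2 = c * ip r \<theta> (\<lambda>t. e1 t + e2 t)"
  moreover have "\<bar>y1\<bar> \<le> 442 / 625 * (4 * \<epsilon> + 49 / 20 * m)" "\<bar>y2\<bar> \<le> 442 / 625 * (4 * \<epsilon> + 49 / 20 * m)"
    using cm[OF h1] cm[OF h2] unfolding y1_def y2_def .
  moreover have "m \<ge> 0" using s AB by (simp add: m_def)
  ultimately have "a + b + ip r e1 v2 + ip r e2 v1 = 2 * (ip r w z - y1 - y2 - ip r \<eta> \<theta>)"
    and y: "\<bar>y1\<bar> \<le> 3 * \<epsilon> + 7 / 4 * m" "\<bar>y2\<bar> \<le> 3 * \<epsilon> + 7 / 4 * m"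
    using eps unfolding c2 by argo+
  then have "\<bar>a + b\<bar> \<le> 29 * \<epsilon> + 7 * m"
    using h3 ev wz eps by argo
  then have ab: "\<bar>a + b\<bar> \<le> 29 * \<epsilon> + 7 * (s * A) + 7 * (s * B)"
    by (simp add: m_def)
  have A2: "A\<^sup>2 = ip r v1 v1 + ip r e1 e1 - 2 * (f * a)"
    using f unfolding A_def nrm_square P_def a_def by (auto simp: ip_linear ip_commute[of r v1 e1])
  have B2: "B\<^sup>2 = ip r v2 v2 + ip r e2 e2 + 2 * (f * b)"
    using f unfolding B_def nrm_square Q_def b_def by (auto simp: ip_linear ip_commute[of r v2 e2])
  have "\<bar>f * a + f * b\<bar> = \<bar>a + b\<bar>" using fabs[of "a + b"] by (simp add: algebra_simps)
  then have BA: "B\<^sup>2 \<le> A\<^sup>2 + 62 * (s * s) + 14 * (s * A) + 14 * (s * B)"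
    using A2 B2 ab e(1,2) v(1,2) unfolding s by argo
  \<comment> \<open>The error terms linear in \<open>s\<close> carry a factor \<open>A\<close> or
    \<open>B\<close>, so completing both squares bounds \<open>B - A\<close> by a multiple of
    \<open>s\<close> even when \<open>A\<close> is tiny. The constants: 49 + 62 is at most 15
    squared, and 15 + 7 = 22.\<close>
  have "B \<le> A + 22 * s"
  proof (rule ccontr)
    assume "\<not> B \<le> A + 22 * s"
    then have gt: "B > A + 22 * s" by simp
    have "(B - 7 * s)\<^sup>2 \<le> (A + 7 * s)\<^sup>2 + 62 * (s * s)"
      using BA by (simp add: power2_eq_square algebra_simps)
    also have "\<dots> \<le> (A + 15 * s)\<^sup>2"
      using AB s(1) by (simp add: power2_eq_square algebra_simps)
    finally have "B - 7 * s \<le> A + 15 * s"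
      by (rule power2_le_imp_le) (use AB s in auto)
    with gt show False by simp
  qed
  then show ?thesis unfolding A_def B_def P_def Q_def s_def .
qed

section \<open>Sign counts and the pairing of indices\<close>

lemma sum_pm_one:
  fixes y :: "'a \<Rightarrow> real"
  assumes "finite S" "\<And>g. g \<in> S \<Longrightarrow> y g \<in> {1, -1}"
  shows "sum y S = real (card S) - 2 * real (card {g \<in> S. y g = -1})"
proof -
  have "sum y S = (\<Sum>g\<in>S. 1 - 2 * (if y g = -1 then 1 else 0))"
    using assms(2) by (intro sum.cong) auto
  also have "\<dots> = real (card S) - 2 * real (card {g \<in> S. y g = -1})"
    using assms(1) by (simp add: sum_subtractf sum_distrib_left[symmetric] sum.If_cases Int_def)
  finally show ?thesis .
qed


lemma nrm_minus_commute: "nrm r (\<lambda>t. - a t + b t) = nrm r (\<lambda>t. a t - b t)"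
  by (simp add: nrm_def ip_def algebra_simps)

lemma pp_facts:
  assumes "i \<in> {1..2 * k}"
  shows "pp i \<in> {1..2 * k}" "pp (pp i) = i" "even (pp i) \<longleftrightarrow> odd i" "pp i \<noteq> i"
proof -
  have "odd i \<Longrightarrow> i \<noteq> 2 * k" by auto
  then show "pp i \<in> {1..2 * k}" using assms by (auto simp: pp_def elim: evenE)
  show "pp (pp i) = i" "even (pp i) \<longleftrightarrow> odd i" "pp i \<noteq> i"
    using assms by (auto simp: pp_def)
qed

section \<open>Alignment of a variable with the reference variable\<close>

text \<open>Diagonal dominance fails at some index, which fixes a sign there; sign propagation then
  carries it to all odd indices. One sign must serve them all because a variable may occur at
  different positions in the clauses.\<close>

lemma variable_alignment:
  assumes k: "k \<ge> 3" and r: "r \<le> 4 * k - 1"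
    and H: "constraints_hold k n m var sg r \<epsilon> u" and x: "x \<in> {1..n}"
  shows "\<exists>f\<in>{1, -1}. \<forall>i\<in>{1..2 * k}. odd i \<longrightarrow>
    nrm r (\<lambda>t. u (VX x (pp i)) t - f * u (VX 0 i) t) \<le> 29 * sqrt k * sqrt \<epsilon>"
proof -
  define E where "E i = u (VX 0 i)" for i
  define V where "V i = u (VX x i)" for i
  let ?K = "{1..2 * k}"
  have x0: "x \<noteq> 0" "0 \<in> {0..n}" "x \<in> {0..n}" using x by auto
  note H' = H[unfolded constraints_hold_def Let_def]
  note I = conjunct1[OF H']
  note J = conjunct1[OF conjunct2[OF H']]
  have hE: "\<bar>ip r (E i) (E j) - (if i = j then 1 else 0)\<bar> \<le> \<epsilon>" if "i \<in> ?K" "j \<in> ?K" for i j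
    using I x0(2) that unfolding E_def by blast
  have hV: "\<bar>ip r (V i) (V j) - (if i = j then 1 else 0)\<bar> \<le> \<epsilon>" if "i \<in> ?K" "j \<in> ?K" for i j
    using I x0(3) that unfolding V_def by blast
  have hEV: "\<bar>ip r (E i) (V j)\<bar> \<le> \<epsilon>" if "i \<in> ?K" "j \<in> ?K" "j \<noteq> pp i" for i j
    using J x that unfolding E_def V_def by force
  have hE1: "\<bar>ip r (E i) (E i) - 1\<bar> \<le> \<epsilon>" and hV1: "\<bar>ip r (V i) (V i) - 1\<bar> \<le> \<epsilon>"
    if "i \<in> ?K" for i using hE[of i i] hV[of i i] that by auto
  have hE0: "\<bar>ip r (E i) (E j)\<bar> \<le> \<epsilon>" and hV0: "\<bar>ip r (V i) (V j)\<bar> \<le> \<epsilon>"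
    if "i \<in> ?K" "j \<in> ?K" "i \<noteq> j" for i j using hE[of i j] hV[of i j] that by auto
  have eps: "\<epsilon> \<ge> 0" using hE1[of 1] k by auto
  define s where "s = sqrt \<epsilon>"
  have s: "s \<ge> 0" "s * s = \<epsilon>" using eps by (auto simp: s_def)

  define W where "W l = u (VX (fst l) (snd l))" for l
  define S where "S = {0, x} \<times> ?K"
  have "finite S" "card S = 4 * k" using x0 by (auto simp: S_def card_cartesian_product)
  moreover have "r < 4 * k" using r k by simp
  ultimately obtain p where p: "p \<in> S"
      and dom: "ip r (W p) (W p) \<le> (\<Sum>l\<in>S - {p}. \<bar>ip r (W l) (W p)\<bar>)"
    using Gram_row_not_dominant[of S r W] by metis
  \<comment> \<open>The only index whose inner product with index \<open>p\<close> is left free by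
    the constraints; all others are within \<open>\<epsilon>\<close> of 0.\<close>
  define p' where "p' = (if fst p = 0 then x else 0, pp (snd p))"
  have sp: "snd p \<in> ?K" using p by (auto simp: S_def)
  have p': "p' \<in> S - {p}"
    using p pp_facts[OF sp] x0 by (auto simp: S_def p'_def split: if_splits)
  have small: "\<bar>ip r (W l) (W p)\<bar> \<le> \<epsilon>" if "l \<in> S - {p} - {p'}" for l
  proof -
    obtain y i where yi: "p = (y, i)" by fastforce
    obtain z j where zj: "l = (z, j)" by fastforce
    have ij: "i \<in> ?K" "j \<in> ?K" and yz: "y \<in> {0, x}" "z \<in> {0, x}"
      using p that by (auto simp: S_def yi zj)
    show ?thesis
    proof (cases "y = z")
      case True
      then show ?thesis
        using that yz hE0[OF ij(2,1)] hV0[OF ij(2,1)] by (auto simp: W_def E_def V_def yi zj)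
    next
      case False
      then have "j \<noteq> pp i" using that yz by (auto simp: yi zj p'_def)
      then have "i \<noteq> pp j" using pp_facts(2)[OF ij(2)] by auto
      show ?thesis
        using False yz hEV[OF ij \<open>j \<noteq> pp i\<close>] hEV[OF ij(2,1) \<open>i \<noteq> pp j\<close>] x0
        by (auto simp: W_def E_def V_def yi zj ip_commute)
    qed
  qed
  have cd: "card (S - {p} - {p'}) = 4 * k - 2"
    using p p' \<open>card S = 4 * k\<close> by (simp add: \<open>finite S\<close>)
  have "(\<Sum>l\<in>S - {p}. \<bar>ip r (W l) (W p)\<bar>)
      = \<bar>ip r (W p') (W p)\<bar> + (\<Sum>l\<in>S - {p} - {p'}. \<bar>ip r (W l) (W p)\<bar>)"
    using p' \<open>finite S\<close> by (simp add: sum.remove)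
  also have "\<dots> \<le> \<bar>ip r (W p') (W p)\<bar> + real (4 * k - 2) * \<epsilon>"
    using sum_bounded_above[of "S - {p} - {p'}", OF small] unfolding cd by simp
  finally have big: "ip r (W p) (W p) \<le> \<bar>ip r (W p') (W p)\<bar> + (4 * real k - 2) * \<epsilon>"
    using dom k by (simp add: of_nat_diff)
  have "ip r (W p) (W p) \<ge> 1 - \<epsilon>"
    using p hE1[OF sp] hV1[OF sp] by (auto simp: S_def W_def E_def V_def)
  then have big: "1 - (4 * real k - 1) * \<epsilon> \<le> \<bar>ip r (W p') (W p)\<bar>"
    using big by (simp add: algebra_simps)
  \<comment> \<open>The failing row may belong to either system; by symmetry of the inner product
    and \<open>pp (pp i) = i\<close>, both cases are expressed through the index on the reference
    side.\<close>
  obtain i where i: "i \<in> ?K" and a: "1 - (4 * real k - 1) * \<epsilon> \<le> \<bar>ip r (E i) (V (pp i))\<bar>"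
  proof (cases "fst p = 0")
    case True
    then show thesis using big sp that[of "snd p"]
      by (simp add: p'_def W_def E_def V_def ip_commute)
  next
    case False
    then have "fst p = x" using p by (auto simp: S_def)
    then show thesis using big pp_facts[OF sp] that[of "pp (snd p)"] x0
      by (simp add: p'_def W_def E_def V_def)
  qed

  define D where "D f i = nrm r (\<lambda>t. V (pp i) t - f * E i t)" for f i
  define q where "q = sqrt k"
  \<comment> \<open>A rational below the square root of 3; at the end it gives
    \<open>44 \<le> 26 * q\<close>.\<close>
  have "17 / 10 \<le> q" unfolding q_def by (rule real_le_rsqrt) (use k in \<open>simp add: power_divide\<close>)
  then have q: "q * q = k" "q \<ge> 17 / 10" by (auto simp: q_def)

  define f0 :: real where "f0 = (if ip r (E i) (V (pp i)) \<ge> 0 then 1 else -1)"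
  have f0: "f0 \<in> {1, -1}" by (simp add: f0_def)
  have "ip r (\<lambda>t. V (pp i) t - f0 * E i t) (\<lambda>t. V (pp i) t - f0 * E i t)
      = ip r (V (pp i)) (V (pp i)) + ip r (E i) (E i) - 2 * \<bar>ip r (E i) (V (pp i))\<bar>"
    by (simp add: ip_linear ip_commute[of r "V (pp i)" "E i"] f0_def)
  \<comment> \<open>The two squared lengths contribute \<open>2 * \<epsilon>\<close> and twice the
    defect contributes \<open>2 * (4 * k - 1) * \<epsilon>\<close>. Next, 8 is rounded up to the
    square 9.\<close>
  also have "\<dots> \<le> 8 * k * \<epsilon>"
    using hV1[of "pp i"] hE1[of i] pp_facts[OF i] i a by (simp add: algebra_simps)
  also have "\<dots> \<le> (3 * q * s)\<^sup>2"
  proof -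
    have "(3 * q * s)\<^sup>2 = 9 * (q * q) * (s * s)" by (simp add: power2_eq_square)
    then show ?thesis using eps unfolding q s by (simp add: mult_right_mono)
  qed
  finally have D0: "D f0 i \<le> 3 * q * s"
    unfolding D_def by (rule nrm_le_of_ip_self_le) (use q s in auto)

  obtain j f where j: "j \<in> ?K" "odd j" and f: "f \<in> {1, -1 :: real}"
      and D1: "D f j \<le> 3 * q * s + 22 * s"
  proof (cases "odd i")
    case True
    then show thesis using that[OF i _ f0] D0 s by simp
  next
    case False
    \<comment> \<open>An even index is exchanged for its odd partner. The two pair vectors of type
      \<open>+1\<close> are nearly orthogonal, so the sign flips inside the pair and
      \<open>- f0\<close> becomes the sign at \<open>j\<close>.\<close>
    define j where "j = pp i"
    have j: "j \<in> ?K" "odd j" "pp j = i" "j < i" "i \<noteq> j"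
      using pp_facts[OF i] False i by (auto simp: j_def pp_def)
    have I0: "\<bar>ip r (u (VP y j i True)) (u (VP y j i True)) - 1\<bar> \<le> \<epsilon>"
      "\<bar>ip r (u (VP y j i True)) (u (VX y j)) - 1 / sqrt 2\<bar> \<le> \<epsilon>"
      "\<bar>ip r (u (VP y j i True)) (u (VX y i)) - 1 / sqrt 2\<bar> \<le> \<epsilon>" if "y \<in> {0..n}" for y
      using I that i j by blast+
    have "\<bar>ip r (u (VP 0 j (pp j) True)) (u (VP x j (pp j) True)) - 0\<bar> \<le> \<epsilon>"
      using J x j(1,2) by blast
    then have wz: "\<bar>ip r (u (VP 0 j i True)) (u (VP x j i True))\<bar> \<le> \<epsilon>" by (simp add: j(3))
    have "nrm r (\<lambda>t. V i t + f0 * E j t) \<le> nrm r (\<lambda>t. V j t - f0 * E i t) + 22 * s"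
      unfolding s_def
      by (rule sign_propagation[OF hE1[OF i] hE1[OF j(1)] hE0[OF i j(1,5)]
            I0(1)[OF x0(2)] I0(3)[OF x0(2), folded E_def] I0(2)[OF x0(2), folded E_def]
            hV1[OF j(1)] hV1[OF i] hV0[OF j(1) i j(5)[symmetric]]
            I0(1)[OF x0(3)] I0(2)[OF x0(3), folded V_def] I0(3)[OF x0(3), folded V_def]
            hEV[OF i i] hEV[OF j(1) j(1)] wz f0])
        (use j in \<open>auto simp: j_def[symmetric]\<close>)
    then have "D (- f0) j \<le> D f0 i + 22 * s"
      using j by (simp add: D_def j_def[symmetric])
    then show thesis using that[OF j(1,2), of "- f0"] f0 D0 by auto
  qed

  have D2: "D f i \<le> 3 * q * s + 44 * s" if i: "i \<in> ?K" "odd i" for i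
  proof -
    \<comment> \<open>Here \<open>z\<close> imitates the normalised difference of
      \<open>V (pp j)\<close> and \<open>V (pp i)\<close>. Substituting \<open>- V (pp i)\<close>
      for the second vector turns it into a sum, and this extra minus cancels the flip: the sign
      \<open>f\<close> is preserved.\<close>
    have step: "D f i \<le> D f j + 22 * s"
      if w: "\<bar>ip r w w - 1\<bar> \<le> \<epsilon>" "\<bar>ip r w (E j) - 1 / sqrt 2\<bar> \<le> \<epsilon>" "\<bar>ip r w (E i) - 1 / sqrt 2\<bar> \<le> \<epsilon>"
       and z: "\<bar>ip r z z - 1\<bar> \<le> \<epsilon>" "\<bar>ip r z (V (pp j)) - 1 / sqrt 2\<bar> \<le> \<epsilon>"
         "\<bar>ip r z (V (pp i)) + 1 / sqrt 2\<bar> \<le> \<epsilon>"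
       and wz: "\<bar>ip r w z\<bar> \<le> \<epsilon>" and ne: "i \<noteq> j" for w z
    proof -
      have ne': "pp i \<noteq> pp j" using pp_facts(2)[OF i(1)] pp_facts(2)[OF j(1)] ne by metis
      have pi: "pp i \<in> ?K" and pj: "pp j \<in> ?K" using pp_facts(1) i(1) j(1) by blast+
      have z': "\<bar>ip r z (\<lambda>t. - V (pp i) t) - 1 / sqrt 2\<bar> \<le> \<epsilon>"
        using z(3) by (simp add: ip_linear abs_minus_commute add.commute)
      have "nrm r (\<lambda>t. - V (pp i) t + f * E i t) \<le> nrm r (\<lambda>t. V (pp j) t - f * E j t) + 22 * s"
        unfolding s_def
        by (rule sign_propagation[OF hE1[OF j(1)] hE1[OF i(1)] hE0[OF j(1) i(1) ne[symmetric]] w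
              hV1[OF pj] _ _ z(1,2) z' _ _ _ f])
          (use hV1[OF pi] hV0[OF pj pi ne'[symmetric]] hEV[OF j(1) pi ne'] hEV[OF i(1) pj ne'[symmetric]] wz
            in \<open>simp_all add: ip_linear\<close>)
      then show ?thesis unfolding D_def nrm_minus_commute .
    qed
    consider "i = j" | "j < i" | "i < j" by linarith
    then have "D f i \<le> D f j + 22 * s"
    proof cases
      case 1
      then show ?thesis using s by simp
    next
      case 2
      then have lt: "pp j < pp i" using i j by (auto simp: pp_def)
      show ?thesis
      proof (rule step[where w = "u (VP 0 j i True)" and z = "u (VP x (pp j) (pp i) False)"])
        show "\<bar>ip r (u (VP 0 j i True)) (u (VP 0 j i True)) - 1\<bar> \<le> \<epsilon>"
          "\<bar>ip r (u (VP 0 j i True)) (E j) - 1 / sqrt 2\<bar> \<le> \<epsilon>"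
          "\<bar>ip r (u (VP 0 j i True)) (E i) - 1 / sqrt 2\<bar> \<le> \<epsilon>"
          unfolding E_def using I x0(2) i(1) j(1) 2 by blast+
        show "\<bar>ip r (u (VP x (pp j) (pp i) False)) (u (VP x (pp j) (pp i) False)) - 1\<bar> \<le> \<epsilon>"
          "\<bar>ip r (u (VP x (pp j) (pp i) False)) (V (pp j)) - 1 / sqrt 2\<bar> \<le> \<epsilon>"
          unfolding V_def using I x0(3) pp_facts(1)[OF i(1)] pp_facts(1)[OF j(1)] lt by blast+
        have "\<bar>ip r (u (VP x (pp j) (pp i) False)) (V (pp i)) - - (1 / sqrt 2)\<bar> \<le> \<epsilon>"
          unfolding V_def using I x0(3) pp_facts(1)[OF i(1)] pp_facts(1)[OF j(1)] lt by blast
        then show "\<bar>ip r (u (VP x (pp j) (pp i) False)) (V (pp i)) + 1 / sqrt 2\<bar> \<le> \<epsilon>" by simp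
        have "\<bar>ip r (u (VP 0 j i True)) (u (VP x (pp j) (pp i) False)) - 0\<bar> \<le> \<epsilon>"
          using J x i j 2 by blast
        then show "\<bar>ip r (u (VP 0 j i True)) (u (VP x (pp j) (pp i) False))\<bar> \<le> \<epsilon>" by simp
      qed (use 2 in auto)
    next
      case 3
      then have lt: "pp i < pp j" using i j by (auto simp: pp_def)
      \<comment> \<open>With the order reversed, the pair vector has its plus sign at
        \<open>pp i\<close>; negating it restores the roles that \<open>step\<close> expects and
        keeps the orthogonality.\<close>
      let ?z = "u (VP x (pp i) (pp j) False)"
      show ?thesis
      proof (rule step[where w = "u (VP 0 i j True)" and z = "\<lambda>t. - ?z t"])
        show "\<bar>ip r (u (VP 0 i j True)) (u (VP 0 i j True)) - 1\<bar> \<le> \<epsilon>"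
          "\<bar>ip r (u (VP 0 i j True)) (E j) - 1 / sqrt 2\<bar> \<le> \<epsilon>"
          "\<bar>ip r (u (VP 0 i j True)) (E i) - 1 / sqrt 2\<bar> \<le> \<epsilon>"
          unfolding E_def using I x0(2) i(1) j(1) 3 by blast+
        have z1: "\<bar>ip r ?z ?z - 1\<bar> \<le> \<epsilon>" and z2: "\<bar>ip r ?z (V (pp i)) - 1 / sqrt 2\<bar> \<le> \<epsilon>"
          and z3: "\<bar>ip r ?z (V (pp j)) - - (1 / sqrt 2)\<bar> \<le> \<epsilon>"
          unfolding V_def using I x0(3) pp_facts(1)[OF i(1)] pp_facts(1)[OF j(1)] lt by blast+
        show "\<bar>ip r (\<lambda>t. - ?z t) (\<lambda>t. - ?z t) - 1\<bar> \<le> \<epsilon>"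
          "\<bar>ip r (\<lambda>t. - ?z t) (V (pp j)) - 1 / sqrt 2\<bar> \<le> \<epsilon>"
          "\<bar>ip r (\<lambda>t. - ?z t) (V (pp i)) + 1 / sqrt 2\<bar> \<le> \<epsilon>"
          using z1 z2 z3 unfolding ip_linear by linarith+
        have "\<bar>ip r (u (VP 0 i j True)) ?z - 0\<bar> \<le> \<epsilon>"
          using J x i j 3 by blast
        then show "\<bar>ip r (u (VP 0 i j True)) (\<lambda>t. - ?z t)\<bar> \<le> \<epsilon>" by (simp add: ip_linear)
      qed (use 3 in auto)
    qed
    then show ?thesis using D1 by linarith
  qed
  have "44 * s \<le> 26 * q * s" using q s by (intro mult_right_mono) auto
  then have "D f i \<le> 29 * q * s" if "i \<in> ?K" "odd i" for i
    using D2[OF that] by simp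
  then show ?thesis using f unfolding D_def E_def V_def q_def s_def by blast
qed

section \<open>From clause vectors to sums of signs\<close>

text \<open>\<open>c0\<close> is nearly the normalised sum of the \<open>e g\<close>, so
  \<open>ip r c0 c\<close> averages the \<open>ip r (e g) c\<close>, and these are nearly
  \<open>\<phi> g * \<sigma> g / sqrt k\<close> because \<open>v g\<close> is close to
  \<open>\<phi> g * e g\<close>. Here \<open>\<sigma>\<close> holds the clause signs and
  \<open>\<phi>\<close> the truth values.\<close>

lemma clause_sum:
  fixes e v :: "nat \<Rightarrow> nat \<Rightarrow> real" and c c0 :: "nat \<Rightarrow> real" and \<sigma> \<phi> :: "nat \<Rightarrow> real"
  assumes k: "k \<ge> 3" and small: "\<epsilon> < 1 / (10^6 * real k ^ 5)"
    and e: "\<And>g h. g \<in> {1..k} \<Longrightarrow> h \<in> {1..k} \<Longrightarrow> \<bar>ip r (e g) (e h) - (if g = h then 1 else 0)\<bar> \<le> \<epsilon>"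
    and c0: "\<bar>ip r c0 c0 - 1\<bar> \<le> \<epsilon>"
    and c0e: "\<And>g. g \<in> {1..k} \<Longrightarrow> \<bar>ip r c0 (e g) - 1 / sqrt k\<bar> \<le> \<epsilon>"
    and c: "\<bar>ip r c c - 1\<bar> \<le> \<epsilon>"
    and cv: "\<And>g. g \<in> {1..k} \<Longrightarrow> \<bar>ip r c (v g) - \<sigma> g / sqrt k\<bar> \<le> \<epsilon>"
    and cc: "\<bar>ip r c0 c - (1 - 2 / real k)\<bar> \<le> \<epsilon>"
    and \<phi>: "\<And>g. g \<in> {1..k} \<Longrightarrow> \<phi> g \<in> {1, -1}"
    and ve: "\<And>g. g \<in> {1..k} \<Longrightarrow> nrm r (\<lambda>t. v g t - \<phi> g * e g t) \<le> 29 * sqrt k * sqrt \<epsilon>"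
  shows "\<bar>(\<Sum>g=1..k. \<phi> g * \<sigma> g) - (real k - 2)\<bar> < 2"
proof -
  have eps: "\<epsilon> \<ge> 0" using c by linarith
  define s where "s = sqrt \<epsilon>"
  define q where "q = sqrt k"
  have s: "s \<ge> 0" "s * s = \<epsilon>" using eps by (auto simp: s_def)
  have q: "q > 0" "q * q = k" using k by (auto simp: q_def)
  have "q \<ge> 1" using k by (simp add: q_def)
  then have qk: "q \<le> k" using mult_left_mono[of 1 q q] q by simp
  \<comment> \<open>All errors are measured in units of \<open>real k ^ 2 * s\<close>, whose square
    is \<open>real k ^ 4 * \<epsilon>\<close>; this unit is below 1/1000.\<close>
  have "real k ^ 4 * \<epsilon> \<le> real k ^ 5 * \<epsilon>"
    using k eps by (intro mult_right_mono power_increasing) auto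
  also have "\<dots> < 1 / 10^6" using small k by (simp add: field_simps)
  also have "real k ^ 4 * \<epsilon> = (real k ^ 2 * s)\<^sup>2"
    unfolding s(2)[symmetric] by (simp add: power2_eq_square power4_eq_xxxx)
  finally have "(real k ^ 2 * s)\<^sup>2 < (1 / 1000)\<^sup>2"
    by (simp add: power_divide)
  then have k2s: "real k ^ 2 * s < 1 / 1000"
    by (rule power2_less_imp_less) simp
  have k1: "1 \<le> real k ^ 2" using k by simp
  have "s \<le> real k ^ 2 * s" using mult_right_mono[OF k1 s(1)] by simp
  then have "s < 1 / 1000" using k2s by linarith
  then have es: "\<epsilon> \<le> s" using s mult_left_mono[of s 1 s] by simp
  then have "\<epsilon> < 1" using \<open>s < 1 / 1000\<close> by linarith

  define d where "d = 1 / q"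
  define \<zeta> where "\<zeta> = (\<lambda>t. c0 t - d * (\<Sum>g=1..k. e g t))"
  have "(\<Sum>g=1..k. 1 / q - \<epsilon>) \<le> (\<Sum>g=1..k. ip r c0 (e g))"
    using c0e by (intro sum_mono) (fastforce simp: q_def)
  then have "k * (1 / q - \<epsilon>) \<le> (\<Sum>g=1..k. ip r c0 (e g))" by simp
  then have "1 / q * (k * (1 / q - \<epsilon>)) \<le> 1 / q * (\<Sum>g=1..k. ip r c0 (e g))"
    using q by (intro mult_left_mono) auto
  moreover have "1 / q * (k * (1 / q - \<epsilon>)) = 1 - q * \<epsilon>"
    using q(1) unfolding q(2)[symmetric] by (simp add: field_simps)
  ultimately have A: "1 - q * \<epsilon> \<le> 1 / q * (\<Sum>g=1..k. ip r c0 (e g))" by simp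
  have "(\<Sum>g=1..k. \<Sum>h=1..k. ip r (e g) (e h)) \<le> (\<Sum>g=1..k. \<Sum>h=1..k. (if g = h then 1 else 0) + \<epsilon>)"
    by (intro sum_mono) (use e in fastforce)
  also have "\<dots> = k * (1 + k * \<epsilon>)"
    by (simp add: sum.distrib algebra_simps)
  finally have "1 / k * (\<Sum>g=1..k. \<Sum>h=1..k. ip r (e g) (e h)) \<le> 1 / k * (k * (1 + k * \<epsilon>))"
    by (intro mult_left_mono) auto
  then have B: "1 / k * (\<Sum>g=1..k. \<Sum>h=1..k. ip r (e g) (e h)) \<le> 1 + k * \<epsilon>"
    using k by simp
  \<comment> \<open>The three groups have main terms 1, -2 and 1, which cancel; \<open>A\<close> and
    \<open>B\<close> control what remains.\<close>
  have "ip r \<zeta> \<zeta> = ip r c0 c0 - 2 * (d * (\<Sum>g=1..k. ip r c0 (e g)))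
      + d * d * (\<Sum>g=1..k. \<Sum>h=1..k. ip r (e g) (e h))"
    unfolding \<zeta>_def by (simp add: ip_linear ip_commute[of r "e _" c0] algebra_simps)
  also have "d * d = 1 / k" using q by (simp add: d_def)
  finally have "ip r \<zeta> \<zeta> \<le> \<epsilon> + 2 * (q * \<epsilon>) + k * \<epsilon>" using A B c0 unfolding d_def by linarith
  also have "\<dots> \<le> 4 * (k * \<epsilon>)"
    using mult_right_mono[OF qk eps] mult_right_mono[OF _ eps, of 1 "real k"] k by linarith
  also have "\<dots> = (2 * q * s)\<^sup>2" unfolding q(2)[symmetric] s(2)[symmetric] by (simp add: power2_eq_square)
  finally have N\<zeta>: "nrm r \<zeta> \<le> 2 * q * s"
    by (rule nrm_le_of_ip_self_le) (use q s in auto)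
  have Nc: "nrm r c \<le> 2"
    by (rule nrm_le_of_ip_self_le) (use c \<open>\<epsilon> < 1\<close> in auto)
  have "\<bar>ip r \<zeta> c\<bar> \<le> 2 * q * s * 2"
    by (rule order_trans[OF ip_Cauchy_Schwarz mult_mono[OF N\<zeta> Nc]]) (use q s nrm_nonneg in auto)
  then have Z: "\<bar>ip r \<zeta> c\<bar> \<le> 4 * (q * s)" by simp

  have each: "\<bar>\<phi> g * \<sigma> g / q - ip r (e g) c\<bar> \<le> \<epsilon> + 58 * (q * s)" if g: "g \<in> {1..k}" for g
  proof -
    let ?D = "\<lambda>t. v g t - \<phi> g * e g t"
    have "\<bar>ip r c ?D\<bar> \<le> 2 * (29 * q * s)"
      by (rule order_trans[OF ip_Cauchy_Schwarz mult_mono[OF Nc]])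
        (use ve[OF g] nrm_nonneg in \<open>auto simp: q_def s_def\<close>)
    \<comment> \<open>Multiplication by \<open>\<phi> g\<close> preserves absolute values and
      \<open>\<phi> g\<close> squares to 1.\<close>
    moreover have "\<bar>\<phi> g * \<sigma> g / q - ip r (e g) c\<bar> = \<bar>(\<sigma> g / q - ip r c (v g)) + ip r c ?D\<bar>"
      using \<phi>[OF g] by (auto simp: ip_linear ip_commute[of r "e g"])
    ultimately show ?thesis using cv[OF g] unfolding q_def[symmetric] by linarith
  qed
  define T where "T = (\<Sum>g=1..k. \<phi> g * \<sigma> g)"
  define M where "M = (\<Sum>g=1..k. ip r (e g) c)"
  have "\<bar>T / q - M\<bar> = \<bar>\<Sum>g=1..k. \<phi> g * \<sigma> g / q - ip r (e g) c\<bar>"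
    by (simp add: T_def M_def sum_subtractf sum_divide_distrib)
  also have "\<dots> \<le> (\<Sum>g=1..k. \<epsilon> + 58 * (q * s))"
    by (rule order_trans[OF sum_abs sum_mono]) (use each in auto)
  finally have TM: "\<bar>T / q - M\<bar> \<le> k * (\<epsilon> + 58 * (q * s))" by simp
  \<comment> \<open>Compare \<open>T\<close> with \<open>k - 2\<close> through \<open>q * M\<close>:
    scaling \<open>k\<close> errors of size \<open>q * s\<close> by \<open>q\<close> gives the unit
    \<open>real k ^ 2 * s\<close>.\<close>
  have "T - q * M = q * (T / q - M)" using q by (simp add: algebra_simps)
  then have "\<bar>T - q * M\<bar> = q * \<bar>T / q - M\<bar>" using q by (simp add: abs_mult)
  also have "\<dots> \<le> q * (k * (\<epsilon> + 58 * (q * s)))" using TM q by (intro mult_left_mono) auto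
  also have "\<dots> = q * k * \<epsilon> + 58 * (k * (q * q) * s)" by (simp add: algebra_simps)
  also have "\<dots> = q * k * \<epsilon> + 58 * (real k ^ 2 * s)" unfolding q(2) by (simp add: power2_eq_square)
  also have "q * k * \<epsilon> \<le> real k ^ 2 * s"
    unfolding power2_eq_square using es eps qk q by (intro mult_mono) auto
  finally have t1: "\<bar>T - q * M\<bar> \<le> 59 * (real k ^ 2 * s)" by linarith
  have "ip r c0 c = ip r \<zeta> c + 1 / q * M"
    unfolding \<zeta>_def M_def d_def[symmetric] by (simp add: ip_linear)
  then have "k * ip r c0 c = k * ip r \<zeta> c + q * M"
    using q(1) unfolding q(2)[symmetric] by (simp add: field_simps)
  then have "q * M - (real k - 2) = k * (ip r c0 c - (1 - 2 / k)) - k * ip r \<zeta> c"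
    using k by (simp add: field_simps)
  also have "\<bar>\<dots>\<bar> \<le> k * \<epsilon> + k * (4 * (q * s))"
    using mult_left_mono[OF cc, of "real k"] mult_left_mono[OF Z, of "real k"]
      abs_triangle_ineq4[of "k * (ip r c0 c - (1 - 2 / k))" "k * ip r \<zeta> c"]
    by (simp add: abs_mult)
  also have "k * \<epsilon> \<le> real k ^ 2 * s"
    using es eps k by (intro mult_mono self_le_power) auto
  also have "k * (4 * (q * s)) \<le> 4 * (real k ^ 2 * s)"
    using mult_left_mono[OF mult_right_mono[OF qk s(1)], of "real k"] by (simp add: power2_eq_square mult_ac)
  finally have "\<bar>q * M - (real k - 2)\<bar> \<le> 5 * (real k ^ 2 * s)" by linarith
  \<comment> \<open>The total error is at most 59 + 5 = 64 units, hence below 2.\<close>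
  then show ?thesis using t1 k2s unfolding T_def[symmetric] by linarith
qed

section \<open>From approximate vectors to a satisfying assignment\<close>

lemma exact_one_sat_if_approximate_constraints:
  assumes k: "k \<ge> 3" and wf: "wf_instance k n m var sg"
    and r: "r \<le> 4 * k - 1" and small: "\<epsilon> < 1 / (10^6 * real k ^ 5)"
    and H: "constraints_hold k n m var sg r \<epsilon> u"
  shows "exact_one_sat k n m var sg"
proof -
  \<comment> \<open>The alignment signs, chosen once per variable, form the assignment.\<close>
  have "\<exists>f. \<forall>x\<in>{1..n}. f x \<in> {1, -1} \<and> (\<forall>i\<in>{1..2 * k}. odd i \<longrightarrow>
    nrm r (\<lambda>t. u (VX x (pp i)) t - f x * u (VX 0 i) t) \<le> 29 * sqrt k * sqrt \<epsilon>)"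
    using variable_alignment[OF k r H] by (intro bchoice) blast
  then obtain f where f: "\<And>x. x \<in> {1..n} \<Longrightarrow> f x \<in> {1, -1 :: real}"
    and fN: "\<And>x i. x \<in> {1..n} \<Longrightarrow> i \<in> {1..2 * k} \<Longrightarrow> odd i \<Longrightarrow>
      nrm r (\<lambda>t. u (VX x (pp i)) t - f x * u (VX 0 i) t) \<le> 29 * sqrt k * sqrt \<epsilon>"
    by blast
  note H' = H[unfolded constraints_hold_def Let_def]
  note C = conjunct2[OF conjunct2[OF H']]
  note C0 = conjunct1[OF C] and C1 = conjunct1[OF conjunct2[OF C]]
    and C2 = conjunct1[OF conjunct2[OF conjunct2[OF C]]]
    and C3 = conjunct2[OF conjunct2[OF conjunct2[OF C]]]
  have "card {g\<in>{1..k}. sg c g * f (var c g) = -1} = 1" if cm: "c \<in> {1..m}" for c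
  proof -
    have vc: "var c g \<in> {1..n}" "sg c g \<in> {1, -1}" if "g \<in> {1..k}" for g
      using wf cm that unfolding wf_instance_def by blast+
    have ppg: "2 * g - 1 \<in> {1..2 * k}" "odd (2 * g - 1)" "pp (2 * g - 1) = 2 * g"
      if "g \<in> {1..k}" for g :: nat using that by (auto simp: pp_def)
    have ve: "nrm r (\<lambda>t. u (VX (var c g) (2 * g)) t - f (var c g) * u (VX 0 (2 * g - 1)) t)
        \<le> 29 * sqrt k * sqrt \<epsilon>" if "g \<in> {1..k}" for g
      using fN[OF vc(1)[OF that] ppg(1,2)[OF that]] ppg(3)[OF that] by simp
    have e: "\<bar>ip r (u (VX 0 (2 * g - 1))) (u (VX 0 (2 * h - 1))) - (if g = h then 1 else 0)\<bar> \<le> \<epsilon>"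
      if gh: "g \<in> {1..k}" "h \<in> {1..k}" for g h
    proof -
      have "\<bar>ip r (u (VX 0 (2 * g - 1))) (u (VX 0 (2 * h - 1)))
          - (if 2 * g - 1 = 2 * h - 1 then 1 else 0)\<bar> \<le> \<epsilon>"
        using conjunct1[OF H'] ppg(1)[OF gh(1)] ppg(1)[OF gh(2)] by (meson atLeastAtMost_iff le0)
      moreover have "2 * g - 1 = 2 * h - 1 \<longleftrightarrow> g = h" using gh by auto
      ultimately show ?thesis by simp
    qed
    have "\<bar>(\<Sum>g=1..k. f (var c g) * sg c g) - (real k - 2)\<bar> < 2"
    proof (rule clause_sum[where e = "\<lambda>g. u (VX 0 (2 * g - 1))" and v = "\<lambda>g. u (VX (var c g) (2 * g))"
          and c = "u (VC c)" and c0 = "u (VC 0)", OF k small e _ _ _ _ _ _ ve])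
      show "\<bar>ip r (u (VC 0)) (u (VC 0)) - 1\<bar> \<le> \<epsilon>"
        by (rule C0)
      show "\<bar>ip r (u (VC c)) (u (VC c)) - 1\<bar> \<le> \<epsilon>"
        using C2 cm by blast
      show "\<bar>ip r (u (VC 0)) (u (VC c)) - (1 - 2 / real k)\<bar> \<le> \<epsilon>"
        using C3 cm by blast
    next
      fix g assume g: "g \<in> {1..k}"
      show "\<bar>ip r (u (VC 0)) (u (VX 0 (2 * g - 1))) - 1 / sqrt k\<bar> \<le> \<epsilon>"
        using C1 g by blast
      show "\<bar>ip r (u (VC c)) (u (VX (var c g) (2 * g))) - sg c g / sqrt k\<bar> \<le> \<epsilon>"
        using C2 cm g by blast
      show "f (var c g) \<in> {1, -1}" by (rule f[OF vc(1)[OF g]])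
    qed
    moreover have "(\<Sum>g=1..k. f (var c g) * sg c g)
        = real k - 2 * real (card {g\<in>{1..k}. sg c g * f (var c g) = -1})"
    proof -
      have "f (var c g) * sg c g \<in> {1, -1}" if "g \<in> {1..k}" for g
        using f[OF vc(1)[OF that]] vc(2)[OF that] by auto
      then show ?thesis using sum_pm_one[of "{1..k}" "\<lambda>g. f (var c g) * sg c g"]
        by (simp add: mult.commute)
    qed
    \<comment> \<open>A count of 0, or of 2 and more, would make this absolute value at least
      2.\<close>
    ultimately have "\<bar>2 - 2 * real (card {g\<in>{1..k}. sg c g * f (var c g) = -1})\<bar> < 2" by simp
    then show ?thesis by linarith
  qed
  then show ?thesis unfolding exact_one_sat_def using f by blast
qed

section \<open>From a satisfying assignment to exact vectors\<close>

text \<open>All vectors are built from one orthonormal basis. A clause vector has the literal values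
  as coordinates on the odd basis vectors, scaled by \<open>1 / sqrt k\<close>, and the reference
  clause has all values 1, so their inner product is the literal sum divided by
  \<open>k\<close>.\<close>

lemma constraints_hold_if_exact_one_sat:
  assumes k: "k \<ge> 3" and wf: "wf_instance k n m var sg" and sat: "exact_one_sat k n m var sg"
  shows "\<exists>u. constraints_hold k n m var sg (2 * k) 0 u"
proof -
  obtain f :: "nat \<Rightarrow> real" where f: "\<And>x. x \<in> {1..n} \<Longrightarrow> f x \<in> {1, -1}"
    and fc: "\<And>c. c \<in> {1..m} \<Longrightarrow> card {g\<in>{1..k}. sg c g * f (var c g) = -1} = 1"
    using sat unfolding exact_one_sat_def by blast
  let ?K = "{1..2 * k}"
  \<comment> \<open>Indices start at 1 and coordinates at 0, hence the \<open>Suc\<close>.\<close>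
  define E :: "nat \<Rightarrow> nat \<Rightarrow> real" where "E i t = (if Suc t = i then 1 else 0)" for i t
  \<comment> \<open>For \<open>x\<close> other than 0 the members of each pair of basis vectors are
    swapped. Opposite signs inside a pair serve the external constraint between two
    \<open>True\<close> vectors; equal signs at equal parity serve the one between
    \<open>True\<close> and \<open>False\<close>.\<close>
  define b where "b x i = (if x = 0 then 1 else if even i then f x else - f x)" for x i :: nat
  define p where "p x i = (if x = 0 then i else pp i)" for x i :: nat
  define X where "X x i = (\<lambda>t. b x i * E (p x i) t)" for x i
  define F where "F c g = (if c = 0 then 1 else sg c g * f (var c g))" for c g :: nat
  define u where "u l = (case l of VX x i \<Rightarrow> X x i
    | VP x i j \<sigma> \<Rightarrow> (\<lambda>t. 1 / sqrt 2 * (X x i t + (if \<sigma> then 1 else -1) * X x j t))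
    | VC c \<Rightarrow> (\<lambda>t. 1 / sqrt k * (\<Sum>g=1..k. F c g * E (2 * g - 1) t)))" for l
  have EE: "ip (2 * k) (E i) (E j) = (if i = j then 1 else 0)" if "i \<in> ?K" for i j
  proof -
    have "ip (2 * k) (E i) (E j) = (\<Sum>t<2 * k. if t = i - 1 then (if i = j then 1 else 0) else 0)"
      unfolding ip_def E_def using that by (intro sum.cong) auto
    then show ?thesis using that by auto
  qed
  have b: "b x i * b x i = 1" if "x \<in> {0..n}" for x i
    using f[of x] that by (cases "x = 0") (auto simp: b_def)
  have pK: "p x i \<in> ?K" if "i \<in> ?K" for x i
    using that pp_facts(1)[OF that] by (simp add: p_def)
  have pinj: "p x i = p x j \<longleftrightarrow> i = j" if "i \<in> ?K" "j \<in> ?K" for x i j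
    using pp_facts(2)[OF that(1)] pp_facts(2)[OF that(2)] unfolding p_def by metis
  have XX: "ip (2 * k) (X x i) (X y j) = b x i * b y j * (if p x i = p y j then 1 else 0)"
    if "i \<in> ?K" for x y i j
    unfolding X_def using EE[OF pK[OF that]] by (simp add: ip_linear)
  have XXx: "ip (2 * k) (X x i) (X x j) = (if i = j then 1 else 0)"
    if "x \<in> {0..n}" "i \<in> ?K" "j \<in> ?K" for x i j
    using XX[OF that(2)] pinj[OF that(2,3)] b[OF that(1)] by simp
  have g1: "2 * g - 1 \<in> ?K" if "g \<in> {1..k}" for g :: nat using that by auto
  have CE: "ip (2 * k) (u (VC c)) (E (2 * g - 1)) = F c g / sqrt k" if g: "g \<in> {1..k}" for c g
  proof -
    have "ip (2 * k) (u (VC c)) (E (2 * g - 1))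
        = 1 / sqrt k * (\<Sum>h=1..k. F c h * (if 2 * h - 1 = 2 * g - 1 then 1 else 0))"
      unfolding u_def vidx.case ip_linear using EE[OF g1] by simp
    also have "(\<Sum>h=1..k. F c h * (if 2 * h - 1 = 2 * g - 1 then 1 else 0))
        = (\<Sum>h=1..k. if h = g then F c g else 0)"
      using g by (intro sum.cong) auto
    finally show ?thesis using g by simp
  qed
  have CC: "ip (2 * k) (u (VC c)) (u (VC d)) = (\<Sum>g=1..k. F c g * F d g) / k" for c d
  proof -
    have "ip (2 * k) (u (VC c)) (u (VC d))
        = 1 / sqrt k * (\<Sum>g=1..k. F d g * ip (2 * k) (u (VC c)) (E (2 * g - 1)))"
      unfolding u_def[of "VC d"] vidx.case ip_linear ..
    also have "\<dots> = 1 / sqrt k * (\<Sum>g=1..k. F d g * (F c g / sqrt k))"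
      using CE by simp
    also have "\<dots> = 1 / (sqrt k * sqrt k) * (\<Sum>g=1..k. F c g * F d g)"
      by (simp add: sum_divide_distrib sum_distrib_left mult_ac)
    finally show ?thesis by simp
  qed
  have F: "F c g \<in> {1, -1}" if "c \<in> {0..m}" "g \<in> {1..k}" for c g
  proof (cases "c = 0")
    case False
    then have "c \<in> {1..m}" using that by simp
    then have "var c g \<in> {1..n}" "sg c g \<in> {1, -1}"
      using wf that(2) unfolding wf_instance_def by blast+
    then show ?thesis using f[of "var c g"] False by (auto simp: F_def)
  qed (simp add: F_def)
  have CC1: "ip (2 * k) (u (VC c)) (u (VC c)) = 1" if "c \<in> {0..m}" for c
  proof -
    have "(\<Sum>g=1..k. F c g * F c g) = (\<Sum>g=1..k. 1)"
      using F[OF that] by (intro sum.cong) force+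
    then show ?thesis using CC k by simp
  qed
  \<comment> \<open>This is where satisfaction enters: exactly one literal is -1, so the literals
    add up to \<open>k - 2\<close>.\<close>
  have C0C: "ip (2 * k) (u (VC 0)) (u (VC c)) = 1 - 2 / k" if "c \<in> {1..m}" for c
  proof -
    have "(\<Sum>g=1..k. F 0 g * F c g) = (\<Sum>g=1..k. F c g)" by (simp add: F_def)
    also have "\<dots> = real k - 2 * real (card {g\<in>{1..k}. F c g = -1})"
      using sum_pm_one[of "{1..k}" "F c"] F[of c] that by simp
    also have "\<dots> = real k - 2" using fc[OF that] that by (simp add: F_def)
    finally show ?thesis using CC k by (simp add: field_simps)
  qed
  \<comment> \<open>The truth value occurs both in the literal and in the variable vector, and its
    square is 1, so only the clause sign is left.\<close>
  have CV: "ip (2 * k) (u (VC c)) (X (var c g) (2 * g)) = sg c g / sqrt k"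
    if "c \<in> {1..m}" "g \<in> {1..k}" for c g
  proof -
    have "var c g \<in> {1..n}" using that wf unfolding wf_instance_def by blast
    then have "X (var c g) (2 * g) = (\<lambda>t. f (var c g) * E (2 * g - 1) t)"
      and "f (var c g) * f (var c g) = 1"
      using f[of "var c g"] by (auto simp: X_def b_def p_def pp_def)
    then show ?thesis using CE[OF that(2)] that(1) by (simp add: ip_linear F_def)
  qed
  have ppp: "pp i \<in> ?K" if "i \<in> ?K" for i using pp_facts(1)[OF that] .
  have "constraints_hold k n m var sg (2 * k) 0 u"
    unfolding constraints_hold_def Let_def abs_le_zero_iff right_minus_eq
  proof (intro conjI ballI allI impI)
    fix x i j s assume "x \<in> {0..n}" "i \<in> ?K" "j \<in> ?K" "i < j"
    then have "ip (2 * k) (X x i) (X x i) = 1" "ip (2 * k) (X x j) (X x j) = 1"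
      "ip (2 * k) (X x i) (X x j) = 0" "ip (2 * k) (X x j) (X x i) = 0"
      using XXx[of x i i] XXx[of x i j] XXx[of x j i] XXx[of x j j] by simp_all
    then show "ip (2 * k) (u (VP x i j s)) (u (VP x i j s)) = 1"
      unfolding u_def vidx.case ip_linear by (simp add: real_div_sqrt)
  next
    fix x i j assume "x \<in> {1..n}" "i \<in> ?K" "j \<in> ?K" "j \<noteq> pp i"
    then show "ip (2 * k) (u (VX 0 i)) (u (VX x j)) = 0"
      using pp_facts(2)[of j k] XX[of i 0 x j] by (auto simp: u_def p_def)
  next
    fix x i assume x: "x \<in> {1..n}" and i: "i \<in> ?K" "odd i"
    have "pp (pp i) = i" "pp i \<noteq> i" "even (pp i)" using pp_facts[OF i(1)] i by auto
    \<comment> \<open>Half the sum of \<open>b x (pp i) = f x\<close> and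
      \<open>b x i = - f x\<close>.\<close>
    then show "ip (2 * k) (u (VP 0 i (pp i) True)) (u (VP x i (pp i) True)) = 0"
      unfolding u_def vidx.case ip_linear XX[OF i(1)] XX[OF ppp[OF i(1)]]
      using x i(2) by (simp add: p_def b_def)
  next
    fix x i j assume x: "x \<in> {1..n}" and i: "i \<in> ?K" and j: "j \<in> ?K" and ij: "i < j \<and> odd i \<and> odd j"
    have "pp (pp i) = i" "even (pp i)" "pp (pp j) = j" "even (pp j)"
      using pp_facts[OF i] pp_facts[OF j] ij by auto
    \<comment> \<open>Both partners are even and carry \<open>f x\<close>, so the minus sign in the
      \<open>False\<close> vector cancels them.\<close>
    then show "ip (2 * k) (u (VP 0 i j True)) (u (VP x (pp i) (pp j) False)) = 0"
      unfolding u_def vidx.case ip_linear XX[OF i] XX[OF j]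
      using x ij by (simp add: p_def b_def)
  next
    fix g assume g: "g \<in> {1..k}"
    have "u (VX 0 (2 * g - 1)) = E (2 * g - 1)" by (simp add: u_def X_def b_def p_def)
    then show "ip (2 * k) (u (VC 0)) (u (VX 0 (2 * g - 1))) = 1 / sqrt k"
      using CE[OF g] by (simp add: F_def)
  next
    fix x i assume "x \<in> {0..n}" "i \<in> ?K"
    then show "ip (2 * k) (u (VX x i)) (u (VX x i)) = 1"
      using XXx[of x i i] by (simp add: u_def)
  next
    fix x i j assume "x \<in> {0..n}" "i \<in> ?K" "j \<in> ?K"
    then show "ip (2 * k) (u (VX x i)) (u (VX x j)) = (if i = j then 1 else 0)"
      using XXx[of x i j] by (simp add: u_def)
  next
    fix x i j assume "x \<in> {0..n}" "i \<in> ?K" "j \<in> ?K" "i < j"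
    then have "ip (2 * k) (X x i) (X x i) = 1" "ip (2 * k) (X x j) (X x j) = 1"
      "ip (2 * k) (X x i) (X x j) = 0" "ip (2 * k) (X x j) (X x i) = 0"
      using XXx[of x i i] XXx[of x i j] XXx[of x j i] XXx[of x j j] by simp_all
    then show "ip (2 * k) (u (VP x i j True)) (u (VX x i)) = 1 / sqrt 2"
      "ip (2 * k) (u (VP x i j True)) (u (VX x j)) = 1 / sqrt 2"
      "ip (2 * k) (u (VP x i j False)) (u (VX x i)) = 1 / sqrt 2"
      "ip (2 * k) (u (VP x i j False)) (u (VX x j)) = - (1 / sqrt 2)"
      unfolding u_def vidx.case ip_linear by simp_all
  next
    show "ip (2 * k) (u (VC 0)) (u (VC 0)) = 1" by (rule CC1) simp
  next
    fix c assume c: "c \<in> {1..m}"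
    then show "ip (2 * k) (u (VC c)) (u (VC c)) = 1" by (intro CC1) simp
    show "ip (2 * k) (u (VC 0)) (u (VC c)) = 1 - 2 / real k" using C0C[OF c] .
    fix g assume "g \<in> {1..k}"
    then show "ip (2 * k) (u (VC c)) (u (VX (var c g) (2 * g))) = sg c g / sqrt (real k)"
      using CV[OF c] by (simp add: u_def)
  qed
  then show ?thesis by blast
qed

theorem theoremC1:
  fixes k n m :: nat and var :: "nat \<Rightarrow> nat \<Rightarrow> nat" and sg :: "nat \<Rightarrow> nat \<Rightarrow> real"
  assumes "k \<ge> 3"
    and "wf_instance k n m var sg"
  shows "(exact_one_sat k n m var sg \<longrightarrow>
            (\<exists>u. constraints_hold k n m var sg (2 * k) 0 u))
       \<and> (\<forall>r eps u. r \<le> 4 * k - 1 \<longrightarrow> eps < 1 / (10^6 * real k ^ 5) \<longrightarrow>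
            constraints_hold k n m var sg r eps u \<longrightarrow> exact_one_sat k n m var sg)"
  using constraints_hold_if_exact_one_sat[OF assms] exact_one_sat_if_approximate_constraints[OF assms] by blast

end
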